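(* Let $V=\{t(i)\in T,\ i\in I\}$ with $0<|I|<\infty$ be a nonempty finite subset of $T$, let $L(i)$, $i\in I$, be sets with $P_+(t(i))\subset L(i)\subset P$ for all $i\in I$, and let $$\mathcal K=\{D\in\mathcal{COP}^p:\ e_k^\top Dt(i)=0\ \ \forall k\in L(i),\ \forall i\in I\}.$$ Let $Z_{\mathcal K}=\{\tau(j),j\in J_{\mathcal K}\}$ be the set of all vertices of $\mathrm{conv}\,T_0(\mathcal K)$, let $M_{\mathcal K}(j)=\{k\in P: e_k^\top D\tau(j)=0\ \forall D\in\mathcal K\}$, $j\in J_{\mathcal K}$, and let $p_*=p(p+1)/2$. Then the dual cone of $\mathcal K$ is $\mathcal K^*=\bar{\mathcal G}$, where $$\bar{\mathcal G}=\Bigl\{D\in\mathcal S(p):\ D=\sum_{i=1}^{p_*}\alpha_i\,\mu(i)(\mu(i))^\top+\sum_{j\in J_{\mathcal K}}\bigl(\lambda(j)(\tau(j))^\top+\tau(j)(\lambda(j))^\top\bigr),$$ $$\alpha_i\ge0,\ \mu(i)\in\Omega(Z_{\mathcal K})\ \ \forall i=1,\dots,p_*;\quad \lambda_k(j)\ge0\ \ \forall k\in P\setminus M_{\mathcal K}(j),\ \forall j\in J_{\mathcal K}\Bigr\},$$ with $\lambda(j)=(\lambda_k(j),k\in P)^\top\in\mathbb R^p$.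
   Context: Let $p>1$ be an integer, $P=\{1,\dots,p\}$, $e_1,\dots,e_p$ the standard basis of $\mathbb R^p$, $\mathcal S(p)$ the space of real symmetric $p\times p$ matrices with the trace inner product $A\bullet B=\mathrm{trace}(AB)$, $\mathcal{COP}^p=\{D\in\mathcal S(p): t^\top Dt\ge 0\ \forall t\in\mathbb R^p_+\}$ the cone of copositive matrices, and $T=\{t\in\mathbb R^p_+: \sum_{k\in P}t_k=1\}$. The dual cone of a cone $C\subset\mathcal S(p)$ is $C^*=\{B\in\mathcal S(p): A\bullet B\ge0\ \forall A\in C\}$. For $t\in\mathbb R^p_+$, $P_+(t)=\{k\in P:t_k>0\}$. For $Q\subset\mathcal{COP}^p$, the set of zeros of $Q$ is $T_0(Q)=\{t\in T: t^\top Dt=0\ \forall D\in Q\}$; for closed convex $Q$ with $T_0(Q)\neq\emptyset$, $\mathrm{conv}\,T_0(Q)$ is a polytope, so its set of vertices (extreme points) is finite. For a nonempty finite set $W=\{w(i),i\in I'\}\subset T$ put $\sigma(W)=\min\{w_k(i): k\in P_+(w(i)),\ i\in I'\}$ and $\Omega(W)=\{t\in T:\rho(t,\mathrm{conv}\,W)\ge\sigma(W)\}$, where $\rho(l,\mathcal B)=\min_{\tau\in\mathcal B}\sum_{k\in P}|l_k-\tau_k|$ is the $\ell_1$-distance and $\mathrm{conv}$ denotes convex hull.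
   Formalization: When Ω(Z_K) is empty (e.g. V all unit vectors, L(i)=P, so K={0} and K^*=S(p)), no μ(i) exists and the set Ḡ as written would be empty; in that case the first sum is taken to be zero. *)

theory Defs
  imports "HOL-Analysis.Analysis"
begin

text \<open>The index set \<open>P = {1,\<dots>,p}\<close> is the finite type \<open>'n\<close>, so \<open>p = CARD('n)\<close>.\<close>

definition sym_matrices :: "(real^'n^'n) set" where
  "sym_matrices = {A. transpose A = A}"

definition copositive :: "(real^'n^'n) set" where
  "copositive = {D \<in> sym_matrices. \<forall>t. (\<forall>k. t $ k \<ge> 0) \<longrightarrow> t \<bullet> (D *v t) \<ge> 0}"

definition simplexT :: "(real^'n) set" where
  "simplexT = {t. (\<forall>k. t $ k \<ge> 0) \<and> (\<Sum>k\<in>UNIV. t $ k) = 1}"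

definition dual_cone :: "(real^'n^'n) set \<Rightarrow> (real^'n^'n) set" where
  "dual_cone C = {B \<in> sym_matrices. \<forall>A\<in>C. trace (A ** B) \<ge> 0}"

definition pos_support :: "real^'n \<Rightarrow> 'n set" where
  "pos_support t = {k. t $ k > 0}"

definition zeros :: "(real^'n^'n) set \<Rightarrow> (real^'n) set" where
  "zeros Q = {t \<in> simplexT. \<forall>D\<in>Q. t \<bullet> (D *v t) = 0}"

definition zero_vertices :: "(real^'n^'n) set \<Rightarrow> (real^'n) set" where
  "zero_vertices Q = {\<tau>. \<tau> extreme_point_of (convex hull (zeros Q))}"

definition sigma_min :: "(real^'n) set \<Rightarrow> real" where
  "sigma_min W = Min {w $ k | w k. w \<in> W \<and> k \<in> pos_support w}"

text \<open>The infimum is attained for the sets used here; see \<open>l1_dist_attained\<close>.\<close>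

definition l1_dist :: "real^'n \<Rightarrow> (real^'n) set \<Rightarrow> real" where
  "l1_dist l B = (INF \<tau>\<in>B. \<Sum>k\<in>UNIV. \<bar>l $ k - \<tau> $ k\<bar>)"

definition Omega :: "(real^'n) set \<Rightarrow> (real^'n) set" where
  "Omega W = {t \<in> simplexT. l1_dist t (convex hull W) \<ge> sigma_min W}"

definition outer :: "real^'n \<Rightarrow> real^'n \<Rightarrow> real^'n^'n" where
  "outer x y = (\<chi> i j. x $ i * y $ j)"

definition M_set :: "(real^'n^'n) set \<Rightarrow> real^'n \<Rightarrow> 'n set" where
  "M_set K \<tau> = {k. \<forall>D\<in>K. axis k 1 \<bullet> (D *v \<tau>) = 0}"

text \<open>The vertices index themselves: \<open>\<tau>(j)\<close> is \<open>\<tau> \<in> zero_vertices K\<close> and \<open>\<lambda>(j)\<close> is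
  \<open>lam \<tau>\<close>.  The sum over them is a genuine finite sum by \<open>finite_zero_vertices\<close>.
  \<open>Omega (zero_vertices K)\<close> can be empty, for instance if \<open>K = {0}\<close>, where every unit vector is
  a vertex; no \<open>\<mu>(i)\<close> can then be chosen, and the first sum is understood to be zero.\<close>

definition G_bar :: "(real^'n^'n) set \<Rightarrow> (real^'n^'n) set" where
  "G_bar K = {D \<in> sym_matrices. \<exists>(\<alpha> :: nat \<Rightarrow> real) (\<mu> :: nat \<Rightarrow> real^'n) (lam :: real^'n \<Rightarrow> real^'n).
     D = (\<Sum>i = 1..CARD('n) * (CARD('n) + 1) div 2. \<alpha> i *\<^sub>R outer (\<mu> i) (\<mu> i))
       + (\<Sum>\<tau>\<in>zero_vertices K. outer (lam \<tau>) \<tau> + outer \<tau> (lam \<tau>)) \<and>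
     (\<forall>i\<in>{1..CARD('n) * (CARD('n) + 1) div 2}. \<alpha> i \<ge> 0 \<and>
        (if Omega (zero_vertices K) = {} then \<alpha> i = 0 else \<mu> i \<in> Omega (zero_vertices K))) \<and>
     (\<forall>\<tau>\<in>zero_vertices K. \<forall>k\<in>UNIV - M_set K \<tau>. lam \<tau> $ k \<ge> 0)}"

lemma l1_dist_attained:
  fixes B :: "(real^'n) set"
  assumes "compact B" "B \<noteq> {}"
  shows "\<exists>\<tau>\<in>B. l1_dist l B = (\<Sum>k\<in>UNIV. \<bar>l $ k - \<tau> $ k\<bar>)"
proof -
  let ?f = "\<lambda>\<tau>::real^'n. \<Sum>k\<in>UNIV. \<bar>l $ k - \<tau> $ k\<bar>"
  have "continuous_on B ?f" by (intro continuous_intros)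
  then obtain \<tau> where \<tau>: "\<tau> \<in> B" "\<And>y. y \<in> B \<Longrightarrow> ?f \<tau> \<le> ?f y"
    using continuous_attains_inf[OF assms] by blast
  have "l1_dist l B = ?f \<tau>"
    unfolding l1_dist_def using \<tau> by (intro cInf_eq_minimum) auto
  with \<tau>(1) show ?thesis by blast
qed

lemma zero_copositive:
  fixes D :: "real^'n^'n"
  assumes D: "D \<in> copositive" and t: "\<And>k. t $ k \<ge> 0" and z: "t \<bullet> (D *v t) = 0"
    and k: "t $ k > 0"
  shows "(D *v t) $ k = 0"
proof -
  have sym: "x \<bullet> (D *v y) = y \<bullet> (D *v x)" for x y
  proof -
    have "transpose D = D" using D by (simp add: copositive_def sym_matrices_def)
    then have "D *v x = x v* D" using transpose_matrix_vector[of D x] by simp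
    then show ?thesis using dot_lmul_matrix[of x D y] by (simp add: inner_commute)
  qed
  have nonneg: "(D *v t) $ j \<ge> 0" for j
  proof (rule ccontr)
    assume "\<not> ?thesis"
    then have neg: "(D *v t) $ j < 0" by simp
    define a where "a = axis j 1 \<bullet> (D *v axis j 1)"
    define e where "e = - (D *v t) $ j / (\<bar>a\<bar> + 1)"
    have e: "e > 0" using neg by (simp add: e_def divide_neg_pos)
    let ?x = "t + e *\<^sub>R axis j 1"
    have "?x \<bullet> (D *v ?x) \<ge> 0"
      using D t e by (auto simp: copositive_def axis_def)
    also have "?x \<bullet> (D *v ?x) = e * (2 * (D *v t) $ j + e * a)"
      using z sym[of t "axis j 1"]
      by (simp add: matrix_vector_right_distrib matrix_vector_mult_scaleR inner_simps a_def
          inner_axis' algebra_simps)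
    finally have "2 * (D *v t) $ j + e * a \<ge> 0"
      using e by (simp add: zero_le_mult_iff)
    moreover have "e * a \<le> e * (\<bar>a\<bar> + 1)" using e by (intro mult_left_mono) auto
    moreover have "e * (\<bar>a\<bar> + 1) = - (D *v t) $ j"
      by (simp add: e_def add_nonneg_eq_0_iff)
    ultimately show False using neg by linarith
  qed
  have "(\<Sum>j\<in>UNIV. t $ j * (D *v t) $ j) = 0" using z by (simp add: inner_vec_def)
  then have "t $ k * (D *v t) $ k = 0"
    using nonneg t by (subst (asm) sum_nonneg_eq_0_iff) auto
  then show ?thesis using k by simp
qed

lemma finite_zero_vertices:
  fixes Q :: "(real^'n^'n) set"
  assumes Q: "Q \<subseteq> copositive"
  shows "finite (zero_vertices Q)"
proof -
  have "inj_on pos_support (zero_vertices Q)"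
  proof (rule inj_onI, rule ccontr)
    fix t s :: "real^'n"
    assume ts: "t \<in> zero_vertices Q" "s \<in> zero_vertices Q"
      and supp: "pos_support t = pos_support s" and ne: "t \<noteq> s"
    have z: "t \<in> zeros Q" "s \<in> zeros Q"
      using ts extreme_point_of_convex_hull by (auto simp: zero_vertices_def)
    have eq: "t $ k > 0 \<longleftrightarrow> s $ k > 0" for k
      using supp unfolding pos_support_def by blast
    from z have t0: "\<And>k. t $ k \<ge> 0" and s0: "\<And>k. s $ k \<ge> 0"
      by (auto simp: zeros_def simplexT_def)
    define e where "e = Min (insert 1 ((\<lambda>k. t $ k) ` pos_support t))"
    have e: "e > 0" "\<And>k. t $ k > 0 \<Longrightarrow> e \<le> t $ k"
      by (auto simp: e_def pos_support_def)
    define u where "u = t + e *\<^sub>R (t - s)"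
    have s1: "s $ k \<le> 1" for k
      using z(2) member_le_sum[of k UNIV "\<lambda>k. s $ k"] by (auto simp: zeros_def simplexT_def)
    have u0: "u $ k \<ge> 0" for k
    proof (cases "t $ k > 0")
      case True
      have "e * s $ k \<le> e * 1" using e s1 by (intro mult_left_mono) auto
      moreover have "e * t $ k \<ge> 0" using e t0[of k] by simp
      ultimately show ?thesis using e(2)[OF True] by (simp add: u_def right_diff_distrib)
    next
      case False
      then have "t $ k = 0" "s $ k = 0"
        using t0[of k] s0[of k] eq[of k] by linarith+
      then show ?thesis by (simp add: u_def)
    qed
    have "(\<Sum>k\<in>UNIV. u $ k) = 1"
      using z by (simp add: u_def zeros_def simplexT_def sum.distrib sum_subtractf
          flip: sum_distrib_left)
    with u0 have uT: "u \<in> simplexT" by (simp add: simplexT_def)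
    have "u \<bullet> (D *v u) = 0" if D: "D \<in> Q" for D
    proof -
      have q: "t \<bullet> (D *v t) = 0" "s \<bullet> (D *v s) = 0" using z D by (auto simp: zeros_def)
      have "s $ k * (D *v t) $ k = 0" for k
      proof (cases "s $ k > 0")
        case True
        then show ?thesis using zero_copositive[of D t k] Q D t0 q eq[of k] by auto
      next
        case False
        then show ?thesis using s0[of k] by simp
      qed
      then have st: "s \<bullet> (D *v t) = 0" by (auto simp: inner_vec_def intro!: sum.neutral)
      have "t $ k * (D *v s) $ k = 0" for k
      proof (cases "t $ k > 0")
        case True
        then show ?thesis using zero_copositive[of D s k] Q D s0 q eq[of k] by auto
      next
        case False
        then show ?thesis using t0[of k] by simp
      qed
      then have ts: "t \<bullet> (D *v s) = 0" by (auto simp: inner_vec_def intro!: sum.neutral)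
      show ?thesis
        by (simp add: u_def matrix_vector_right_distrib matrix_vector_mult_diff_distrib
            matrix_vector_mult_scaleR inner_simps q st ts)
    qed
    with uT have uz: "u \<in> zeros Q" by (simp add: zeros_def)
    have "t \<in> open_segment s u"
    proof -
      define a where "a = 1 / (1 + e)"
      have a: "a + a * e = 1" using e by (simp add: a_def divide_simps)
      have "(1 - a) *\<^sub>R s + a *\<^sub>R u = s + (a + a * e) *\<^sub>R (t - s)"
        by (simp add: u_def algebra_simps)
      then have "t = (1 - a) *\<^sub>R s + a *\<^sub>R u" by (simp add: a)
      moreover have "s \<noteq> u"
      proof
        assume "s = u"
        then have "(1 + e) *\<^sub>R (t - s) = 0" by (simp add: u_def algebra_simps)
        then show False using e ne by simp
      qed
      moreover have "0 < a" "a < 1" using e by (auto simp: a_def)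
      ultimately show ?thesis unfolding in_segment by blast
    qed
    moreover have "s \<in> convex hull zeros Q" "u \<in> convex hull zeros Q"
      using z uz by (auto intro: hull_inc)
    ultimately show False
      using ts(1) by (auto simp: zero_vertices_def extreme_point_of_def)
  qed
  then show ?thesis using finite_imageD[of pos_support] by (simp add: finite_subset[OF subset_UNIV])
qed

end

(* A symmetric D lies in K iff D tau(j) >= 0 componentwise for every vertex tau(j), with equality on
   M(j), and D is nonnegative on Omega(Z): copositivity is checked by descent on the support of t,
   and the equations at t(i) pass from the vertices because t(i) is a convex combination of them.
   Hence K is cut out by linear inequalities whose normals generate G_bar.  The cone of these normals
   is closed, because it is the sum of a polyhedral cone and a cone over the compact set of all
   mu mu^T with mu in Omega(Z), and a single D in K is strictly positive on that compact set.
   Separation then gives K^* = G_bar, with Caratheodory's theorem in the space of symmetric matrices,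
   of dimension p(p+1)/2, bounding the number of terms mu mu^T. *)

theory Submission
  imports Defs
begin

section \<open>Trace pairing and symmetric outer products\<close>

lemma inner_outer:
  fixes A :: "real^'n^'n"
  shows "A \<bullet> outer x y = x \<bullet> (A *v y)"
  by (simp add: inner_vec_def outer_def matrix_vector_mult_def sum_distrib_left mult_ac)

text \<open>Identifies the pairing in \<open>dual_cone\<close> with the Euclidean inner product, so
  that separation by hyperplanes applies directly.\<close>

lemma trace_mult_symmetric:
  fixes A B :: "real^'n^'n"
  assumes "B \<in> sym_matrices"
  shows "trace (A ** B) = A \<bullet> B"
proof -
  have "B $ i $ j = B $ j $ i" for i j
    using assms unfolding sym_matrices_def transpose_def vec_eq_iff mem_Collect_eq by simp
  then show ?thesis
    by (simp add: trace_def matrix_matrix_mult_def inner_vec_def)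
qed

lemma transpose_inner:
  fixes A B :: "real^'n^'n"
  shows "transpose A \<bullet> B = A \<bullet> transpose B"
  unfolding inner_vec_def transpose_def by (simp, rule sum.swap)

lemma transpose_outer: "transpose (outer x y) = outer y x"
  by (simp add: vec_eq_iff transpose_def outer_def mult.commute)

lemma outer_sym: "outer x x \<in> sym_matrices" "outer x y + outer y x \<in> sym_matrices"
  by (auto simp: sym_matrices_def vec_eq_iff transpose_def outer_def)

lemma outer_add_left: "outer (x + y) z = outer x z + outer y z"
  and outer_add_right: "outer z (x + y) = outer z x + outer z y"
  and outer_scaleR_left: "outer (r *\<^sub>R x) z = r *\<^sub>R outer x z"
  and outer_scaleR_right: "outer z (r *\<^sub>R x) = r *\<^sub>R outer z x"
  and outer_zero: "outer 0 z = 0" "outer z 0 = 0"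
  by (auto simp: vec_eq_iff outer_def algebra_simps)

lemma sym_bilinear_commute:
  assumes "D \<in> sym_matrices"
  shows "x \<bullet> (D *v y) = y \<bullet> (D *v x)"
proof -
  have "D \<bullet> outer x y = D \<bullet> outer y x"
    using transpose_inner[of D "outer x y"] assms by (simp add: sym_matrices_def transpose_outer)
  then show ?thesis by (simp add: inner_outer)
qed

lemma axis_inner_mult [simp]: "axis k 1 \<bullet> (D *v x) = ((D *v x) $ k :: real)"
  by (simp add: inner_axis')

lemma nonneg_inner:
  fixes x y :: "real^'n"
  assumes "\<And>k. x $ k \<ge> 0" "\<And>k. y $ k \<ge> 0"
  shows "x \<bullet> y \<ge> 0"
  using assms by (simp add: inner_vec_def sum_nonneg)

text \<open>A zero minimises the form on the orthant, so no coordinate direction can decrease it to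
  first order. Coordinates outside the support of \<open>t\<close> are included, where only the sign
  is controlled.\<close>

lemma copositive_zero_gradient_nonneg:
  fixes D :: "real^'n^'n"
  assumes D: "D \<in> copositive" and t: "\<And>k. t $ k \<ge> 0" and z: "t \<bullet> (D *v t) = 0"
  shows "(D *v t) $ j \<ge> 0"
proof (rule ccontr)
  assume "\<not> ?thesis"
  then have neg: "(D *v t) $ j < 0" by simp
  have sym: "D \<in> sym_matrices" using D by (simp add: copositive_def)
  define a where "a = (D *v axis j 1) $ j"
  \<comment> \<open>This step length gives \<open>e * (\<bar>a\<bar> + 1) = - (D *v t) $ j\<close>,
    so the quadratic term cannot compensate for the negative linear term.\<close>
  define e where "e = - (D *v t) $ j / (\<bar>a\<bar> + 1)"
  have e: "e > 0" using neg by (simp add: e_def divide_neg_pos)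
  let ?x = "t + e *\<^sub>R axis j 1"
  have "?x \<bullet> (D *v ?x) \<ge> 0"
    using D t e by (auto simp: copositive_def axis_def)
  also have "?x \<bullet> (D *v ?x) = e * (2 * (D *v t) $ j + e * a)"
    using z sym_bilinear_commute[OF sym, of t "axis j 1"]
    by (simp add: matrix_vector_right_distrib matrix_vector_mult_scaleR inner_simps a_def
        algebra_simps)
  finally have "2 * (D *v t) $ j + e * a \<ge> 0"
    using e by (simp add: zero_le_mult_iff)
  moreover have "e * a \<le> e * (\<bar>a\<bar> + 1)" using e by (intro mult_left_mono) auto
  moreover have "e * (\<bar>a\<bar> + 1) = - (D *v t) $ j"
    by (simp add: e_def add_nonneg_eq_0_iff)
  ultimately show False using neg by linarith
qed

section \<open>The simplex, sigma and the set Omega\<close>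

lemma simplexT_nonneg: "t \<in> simplexT \<Longrightarrow> t $ k \<ge> 0"
  by (simp add: simplexT_def)

text \<open>Replaces the infimum by one condition for each point of \<open>B\<close>; membership in
  \<open>Omega\<close> thereby becomes an intersection of closed conditions.\<close>

lemma le_l1_dist_iff:
  assumes "B \<noteq> {}"
  shows "s \<le> l1_dist t B \<longleftrightarrow> (\<forall>\<tau>\<in>B. s \<le> (\<Sum>k\<in>UNIV. \<bar>t $ k - \<tau> $ k\<bar>))"
  unfolding l1_dist_def using assms
  by (intro le_cINF_iff) (auto intro!: bdd_belowI[of _ 0] sum_nonneg)

lemma finite_positive_components:
  fixes W :: "(real^'n) set"
  assumes "finite W"
  shows "finite {w $ k | w k. w \<in> W \<and> k \<in> pos_support w}"
proof (rule finite_subset)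
  show "{w $ k | w k. w \<in> W \<and> k \<in> pos_support w} \<subseteq> (\<lambda>(w, k). w $ k) ` (W \<times> UNIV)"
    by auto
qed (use assms in simp)

lemma sigma_min_le:
  fixes W :: "(real^'n) set"
  assumes "finite W" "w \<in> W" "w $ k > 0"
  shows "sigma_min W \<le> w $ k"
  unfolding sigma_min_def
  using assms finite_positive_components[OF assms(1)] by (intro Min_le) (auto simp: pos_support_def)

text \<open>Coordinates of a simplex point sum to one, so the minimum is over a nonempty finite set
  of positive numbers.\<close>

lemma sigma_min_pos:
  fixes W :: "(real^'n) set"
  assumes "finite W" "W \<noteq> {}" "W \<subseteq> simplexT"
  shows "sigma_min W > 0"
proof -
  let ?S = "{w $ k | w k. w \<in> W \<and> k \<in> pos_support w}"
  obtain w where w: "w \<in> W" using assms(2) by blast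
  then have "w \<in> simplexT" using assms(3) by blast
  then have "(\<Sum>k\<in>UNIV. w $ k) > 0" by (simp add: simplexT_def)
  then have "\<exists>k. w $ k > 0" by (meson linorder_not_le sum_nonpos)
  then have "?S \<noteq> {}" using w by (auto simp: pos_support_def)
  then show ?thesis
    unfolding sigma_min_def using finite_positive_components[OF assms(1)] by (subst Min_gr_iff) (auto simp: pos_support_def)
qed

text \<open>On the coordinates where \<open>t\<close> vanishes every \<open>w \<in> W\<close> has mass at least \<open>\<sigma>(W)\<close>, and this
  passes to convex combinations.\<close>

lemma Omega_memI:
  fixes W :: "(real^'n) set"
  assumes W: "finite W" "W \<noteq> {}" "W \<subseteq> simplexT" and t: "t \<in> simplexT"
    and supp: "\<And>w. w \<in> W \<Longrightarrow> \<not> pos_support w \<subseteq> pos_support t"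
  shows "t \<in> Omega W"
proof -
  define N where "N = - pos_support t"
  let ?H = "{\<tau>::real^'n. sigma_min W \<le> (\<Sum>k\<in>N. \<tau> $ k)} \<inter> {\<tau>. \<forall>k. \<tau> $ k \<ge> 0}"
  have N: "t $ k = 0" if "k \<in> N" for k
    using that simplexT_nonneg[OF t, of k] by (auto simp: N_def pos_support_def)
  have "convex {\<tau>::real^'n. sigma_min W \<le> (\<Sum>k\<in>N. \<tau> $ k)}"
  proof -
    have "(\<Sum>k\<in>N. \<tau> $ k) = (\<Sum>k\<in>N. axis k 1) \<bullet> \<tau>" for \<tau> :: "real^'n"
      by (simp add: inner_sum_left inner_axis')
    then show ?thesis using convex_halfspace_ge[of "sigma_min W" "(\<Sum>k\<in>N. axis k 1)"]
      by simp
  qed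
  then have "convex ?H"
    by (intro convex_Int) (auto intro!: convexI add_nonneg_nonneg)
  moreover have "W \<subseteq> ?H"
  proof
    fix w assume w: "w \<in> W"
    have w0: "\<And>k. w $ k \<ge> 0" using w W(3) simplexT_nonneg by blast
    obtain k where k: "w $ k > 0" "k \<in> N"
      using supp[OF w] by (auto simp: pos_support_def N_def)
    have "sigma_min W \<le> w $ k" using sigma_min_le W(1) w k(1) by blast
    also have "\<dots> \<le> (\<Sum>k\<in>N. w $ k)" using k w0 by (intro member_le_sum) auto
    finally show "w \<in> ?H" using w0 by simp
  qed
  ultimately have hull: "convex hull W \<subseteq> ?H" by (intro hull_minimal)
  have "sigma_min W \<le> (\<Sum>k\<in>UNIV. \<bar>t $ k - \<tau> $ k\<bar>)" if "\<tau> \<in> convex hull W" for \<tau>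
  proof -
    have "sigma_min W \<le> (\<Sum>k\<in>N. \<tau> $ k)" using hull that by auto
    also have "\<dots> \<le> (\<Sum>k\<in>N. \<bar>t $ k - \<tau> $ k\<bar>)" using N by (intro sum_mono) auto
    also have "\<dots> \<le> (\<Sum>k\<in>UNIV. \<bar>t $ k - \<tau> $ k\<bar>)" by (intro sum_mono2) auto
    finally show ?thesis .
  qed
  then show ?thesis
    using t W(2) by (simp add: Omega_def le_l1_dist_iff)
qed

section \<open>Compactness, vertices, and a copositivity test\<close>

lemma compact_simplexT: "compact (simplexT :: (real^'n) set)"
proof -
  have "simplexT = (\<Inter>k. {t::real^'n. 0 \<le> t $ k}) \<inter> {t. (\<Sum>k\<in>UNIV. t $ k) = 1}"
    by (auto simp: simplexT_def)
  moreover have "closed \<dots>"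
    by (intro closed_Int closed_INT ballI closed_Collect_le closed_Collect_eq continuous_intros)
  moreover have "bounded (simplexT :: (real^'n) set)"
  proof (rule boundedI)
    fix t :: "real^'n" assume t: "t \<in> simplexT"
    have "norm t \<le> (\<Sum>k\<in>UNIV. \<bar>t $ k\<bar>)" by (rule norm_le_l1_cart)
    also have "\<dots> = 1" using t by (simp add: simplexT_def)
    finally show "norm t \<le> 1" .
  qed
  ultimately show ?thesis by (simp add: compact_eq_bounded_closed)
qed

lemma compact_Omega:
  fixes W :: "(real^'n) set"
  assumes "W \<noteq> {}"
  shows "compact (Omega W)"
proof -
  have "Omega W = simplexT \<inter>
      (\<Inter>\<tau>\<in>convex hull W. {t. sigma_min W \<le> (\<Sum>k\<in>UNIV. \<bar>t $ k - \<tau> $ k\<bar>)})"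
    using assms by (auto simp: Omega_def le_l1_dist_iff)
  moreover have "compact \<dots>"
    by (intro compact_Int_closed compact_simplexT closed_INT ballI closed_Collect_le continuous_intros)
  ultimately show ?thesis by simp
qed

lemma compact_zeros: "compact (zeros (Q :: (real^'n^'n) set))"
proof -
  have "zeros Q = simplexT \<inter> (\<Inter>D\<in>Q. {t. t \<bullet> (D *v t) = 0})"
    by (auto simp: zeros_def)
  moreover have "compact \<dots>"
    by (intro compact_Int_closed compact_simplexT closed_INT ballI closed_Collect_eq
        continuous_intros matrix_vector_mult_linear_continuous_on)
  ultimately show ?thesis by simp
qed

lemma zero_vertices_subset: "zero_vertices Q \<subseteq> zeros Q"
  using extreme_point_of_convex_hull by (auto simp: zero_vertices_def)

text \<open>Krein-Milman in finite dimension, applied to the hull of the compact set of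
  zeros.\<close>

lemma convex_hull_zero_vertices: "convex hull zero_vertices Q = convex hull zeros Q"
  unfolding zero_vertices_def
  by (metis Krein_Milman_Minkowski compact_zeros compact_convex_hull convex_convex_hull)

text \<open>A point of the hull has distance zero from it, whereas \<open>sigma_min W\<close> is
  positive.\<close>

lemma Omega_disjoint_hull:
  fixes W :: "(real^'n) set"
  assumes "finite W" "W \<noteq> {}" "W \<subseteq> simplexT"
  shows "Omega W \<inter> convex hull W = {}"
proof -
  have "t \<notin> Omega W" if t: "t \<in> convex hull W" for t
  proof
    assume "t \<in> Omega W"
    then have "sigma_min W \<le> (\<Sum>k\<in>UNIV. \<bar>t $ k - t $ k\<bar>)"
      using t assms(2) by (auto simp: Omega_def le_l1_dist_iff)
    then show False using sigma_min_pos[OF assms] by simp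
  qed
  then show ?thesis by blast
qed

text \<open>Descent on the support of \<open>t\<close>: if the support contains that of some \<open>w \<in> W\<close>, subtract the
  largest possible multiple of \<open>w\<close>, which does not increase the form; otherwise \<open>t\<close> normalises to a
  point of \<open>\<Omega>(W)\<close>.\<close>

lemma copositiveI_Omega:
  fixes D :: "real^'n^'n"
  assumes D: "D \<in> sym_matrices" and W: "finite W" "W \<noteq> {}" "W \<subseteq> simplexT"
    and grad: "\<And>w k. w \<in> W \<Longrightarrow> (D *v w) $ k \<ge> 0"
    and Om: "\<And>\<mu>. \<mu> \<in> Omega W \<Longrightarrow> \<mu> \<bullet> (D *v \<mu>) \<ge> 0"
  shows "D \<in> copositive"
proof -
  have "t \<bullet> (D *v t) \<ge> 0" if "\<And>k. t $ k \<ge> 0" for t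
    using that
  proof (induction "card (pos_support t)" arbitrary: t rule: less_induct)
    case less
    note t0 = less.prems
    show ?case
    proof (cases "\<exists>w\<in>W. pos_support w \<subseteq> pos_support t")
      case True
      then obtain w where w: "w \<in> W" "pos_support w \<subseteq> pos_support t" by blast
      have wT: "w \<in> simplexT" using w W by blast
      have w0: "w $ k \<ge> 0" for k using wT simplexT_nonneg by blast
      have ne: "pos_support w \<noteq> {}"
      proof
        assume "pos_support w = {}"
        then have "w $ k \<le> 0" for k by (auto simp: pos_support_def not_less)
        then have "(\<Sum>k\<in>UNIV. w $ k) \<le> 0" by (intro sum_nonpos)
        then show False using wT by (simp add: simplexT_def)
      qed
      \<comment> \<open>The largest multiple of \<open>w\<close> that can be subtracted from
        \<open>t\<close> within the orthant; a minimising index \<open>m\<close> leaves the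
        support.\<close>
      define e where "e = Min ((\<lambda>k. t $ k / w $ k) ` pos_support w)"
      have e_le: "e \<le> t $ k / w $ k" if "k \<in> pos_support w" for k
        unfolding e_def using that by (intro Min_le) auto
      have "e \<in> (\<lambda>k. t $ k / w $ k) ` pos_support w"
        unfolding e_def using ne by (intro Min_in) auto
      then obtain m where m: "m \<in> pos_support w" "e = t $ m / w $ m" by blast
      have e0: "e \<ge> 0" using m t0 w0 by simp
      define s where "s = t - e *\<^sub>R w"
      have s0: "s $ k \<ge> 0" for k
      proof (cases "k \<in> pos_support w")
        case True
        then show ?thesis using e_le[OF True] by (simp add: s_def pos_support_def pos_le_divide_eq)
      next
        case False
        then have "w $ k = 0" using w0[of k] by (simp add: pos_support_def)
        then show ?thesis using t0 by (simp add: s_def)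
      qed
      have "s $ k \<le> t $ k" for k using e0 w0 by (simp add: s_def)
      then have "pos_support s \<subseteq> pos_support t"
        unfolding pos_support_def using less_le_trans by blast
      moreover have "m \<notin> pos_support s" using m by (simp add: pos_support_def s_def)
      moreover have "m \<in> pos_support t" using m w by blast
      ultimately have "card (pos_support s) < card (pos_support t)"
        by (intro psubset_card_mono) auto
      then have IH: "s \<bullet> (D *v s) \<ge> 0" using less.hyps s0 by blast
      have sw: "s \<bullet> (D *v w) \<ge> 0" "w \<bullet> (D *v w) \<ge> 0"
        using grad[OF w(1)] s0 w0 by (auto intro!: nonneg_inner)
      have ts: "t = s + e *\<^sub>R w" by (simp add: s_def)
      \<comment> \<open>The cross term and the last term are nonnegative by the gradient condition
        at \<open>w\<close>, so passing from \<open>t\<close> to \<open>s\<close> does not increase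
        the form.\<close>
      have "t \<bullet> (D *v t) = s \<bullet> (D *v s) + 2 * e * (s \<bullet> (D *v w)) + e * e * (w \<bullet> (D *v w))"
        unfolding ts using sym_bilinear_commute[OF D, of w s]
        by (simp add: matrix_vector_right_distrib matrix_vector_mult_scaleR inner_simps
            algebra_simps)
      then show ?thesis using IH sw e0 by simp
    next
      case False
      define r where "r = (\<Sum>k\<in>UNIV. t $ k)"
      show ?thesis
      proof (cases "t = 0")
        case False
        then have "r > 0"
          unfolding r_def using t0
          by (metis (no_types, lifting) UNIV_I finite order_le_less sum_nonneg sum_nonneg_eq_0_iff
              vec_eq_iff zero_index)
        define u where "u = (1 / r) *\<^sub>R t"
        have "u \<in> simplexT"
          using \<open>r > 0\<close> t0 by (simp add: simplexT_def u_def r_def flip: sum_divide_distrib)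
        moreover have "pos_support u = pos_support t"
          using \<open>r > 0\<close> by (simp add: pos_support_def u_def zero_less_divide_iff)
        ultimately have "u \<in> Omega W"
          using Omega_memI[OF W] \<open>\<not> (\<exists>w\<in>W. _ w)\<close> by blast
        then have "u \<bullet> (D *v u) \<ge> 0" by (rule Om)
        moreover have "t = r *\<^sub>R u" using \<open>r > 0\<close> by (simp add: u_def)
        ultimately show ?thesis
          using \<open>r > 0\<close> by (simp add: matrix_vector_mult_scaleR)
      qed simp
    qed
  qed
  then show ?thesis using D by (simp add: copositive_def)
qed

section \<open>Convex cones: positivity, separation and closedness\<close>

lemma convex_cone_sum:
  assumes "convex_cone S" "finite B" "B \<subseteq> S"
  shows "\<Sum>B \<in> S"
  using assms(2,3)
  by (induction B rule: finite_induct)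
     (auto simp: convex_cone_contains_0[OF assms(1)] convex_cone_add[OF assms(1)])

text \<open>The witness is the sum of a basis of the span of \<open>Q\<close> taken from \<open>Q\<close>.\<close>

lemma ex_positive_off_zeros:
  fixes Q :: "(real^'n^'n) set"
  assumes Q: "Q \<subseteq> copositive" "convex_cone Q"
  shows "\<exists>D\<in>Q. \<forall>t \<in> simplexT - zeros Q. t \<bullet> (D *v t) > 0"
proof -
  obtain B where B: "B \<subseteq> Q" "independent B" "Q \<subseteq> span B" "card B = dim Q"
    by (rule basis_exists[of Q])
  have fin: "finite B" using B(2) by (simp add: independent_imp_finite)
  have "\<Sum>B \<in> Q" using Q(2) fin B(1) by (rule convex_cone_sum)
  moreover have "t \<bullet> (\<Sum>B *v t) > 0" if t: "t \<in> simplexT - zeros Q" for t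
  proof -
    have nn: "b \<bullet> outer t t \<ge> 0" if "b \<in> B" for b
      using that B(1) Q(1) t by (auto simp: copositive_def simplexT_def inner_outer)
    have eq: "t \<bullet> (\<Sum>B *v t) = (\<Sum>b\<in>B. b \<bullet> outer t t)"
      by (simp add: inner_sum_left flip: inner_outer)
    \<comment> \<open>The value at \<open>t\<close> is linear in the matrix. If it vanishes on all
      of \<open>B\<close>, it vanishes on the span, hence on \<open>Q\<close>, and \<open>t\<close>
      would be a common zero.\<close>
    have False if "(\<Sum>b\<in>B. b \<bullet> outer t t) = 0"
    proof -
      have "\<forall>b\<in>B. b \<bullet> outer t t = 0"
        using that nn fin by (simp add: sum_nonneg_eq_0_iff)
      then have "B \<subseteq> {x. outer t t \<bullet> x = 0}" by (auto simp: inner_commute)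
      then have "span B \<subseteq> {x. outer t t \<bullet> x = 0}"
        by (intro span_minimal subspace_hyperplane)
      then have "\<forall>D\<in>Q. t \<bullet> (D *v t) = 0"
        using B(3) by (auto simp: inner_commute simp flip: inner_outer)
      then show False using t by (simp add: zeros_def)
    qed
    then show ?thesis using eq nn sum_nonneg[of B "\<lambda>b. b \<bullet> outer t t"] by fastforce
  qed
  ultimately show ?thesis by blast
qed

text \<open>A strict separating threshold \<open>b\<close> is negative because the cone contains 0.
  A point with negative value could be scaled to have value exactly \<open>b\<close>, so the
  threshold may be moved to 0.\<close>

lemma convex_cone_separation:
  fixes S :: "'a::euclidean_space set"
  assumes S: "closed S" "convex_cone S" and x: "x \<notin> S"
  obtains a where "a \<bullet> x < 0" "\<And>y. y \<in> S \<Longrightarrow> a \<bullet> y \<ge> 0"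
proof -
  obtain a b where ab: "a \<bullet> x < b" "\<And>y. y \<in> S \<Longrightarrow> a \<bullet> y > b"
    using separating_hyperplane_closed_point[of S x] S x by (auto simp: convex_cone_def)
  have b: "b < 0" using ab(2)[OF convex_cone_contains_0[OF S(2)]] by simp
  have "a \<bullet> y \<ge> 0" if y: "y \<in> S" for y
  proof (rule ccontr)
    assume "\<not> ?thesis"
    then have neg: "a \<bullet> y < 0" by simp
    then have "(b / (a \<bullet> y)) *\<^sub>R y \<in> S"
      using S(2) y b by (intro convex_cone_scaleR) (auto simp: divide_nonpos_neg)
    then have "a \<bullet> ((b / (a \<bullet> y)) *\<^sub>R y) > b" by (rule ab(2))
    then show False using neg by simp
  qed
  moreover have "a \<bullet> x < 0" using ab(1) b by simp
  ultimately show ?thesis by (rule that[rotated])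
qed

lemma convex_cone_hull_decompose:
  fixes S :: "'a::real_vector set"
  assumes "x \<in> convex_cone hull S"
  shows "x = 0 \<or> (\<exists>r a. r \<ge> 0 \<and> a \<in> convex hull S \<and> x = r *\<^sub>R a)"
  using assms unfolding convex_cone_hull_separate conic_hull_explicit by auto

text \<open>The functional \<open>d\<close> bounds the multiplier of the compact base near a limit point, so locally
  the sum is one of a compact and a closed set.\<close>

lemma closed_compactly_generated_plus_closed_cone:
  fixes A C :: "'a::euclidean_space set"
  assumes A: "compact A" and C: "closed C"
    and dA: "\<And>a. a \<in> A \<Longrightarrow> d \<bullet> a > 0" and dC: "\<And>c. c \<in> C \<Longrightarrow> d \<bullet> c \<ge> 0"
  shows "closed {x + c | x c. x \<in> convex_cone hull A \<and> c \<in> C}" (is "closed ?S")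
proof -
  define H where "H = convex hull A"
  have H: "compact H" unfolding H_def using A by (rule compact_convex_hull)
  have dH: "H \<subseteq> {x. d \<bullet> x > 0}"
    unfolding H_def using dA by (intro hull_minimal convex_halfspace_gt) auto
  obtain m where m: "m > 0" "\<And>a. a \<in> H \<Longrightarrow> m \<le> d \<bullet> a"
  proof (cases "H = {}")
    case False
    have "continuous_on H (\<lambda>a. d \<bullet> a)" by (intro continuous_intros)
    from continuous_attains_inf[OF H False this]
    obtain y where "y \<in> H" "\<forall>a\<in>H. d \<bullet> y \<le> d \<bullet> a" by blast
    then show ?thesis using that[of "d \<bullet> y"] dH by auto
  qed (use that[of 1] in auto)
  have "x \<in> ?S" if x: "x \<in> closure ?S" for x
  proof -
    \<comment> \<open>If \<open>r *\<^sub>R a + c\<close> has \<open>d\<close>-value below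
      \<open>d \<bullet> x + 1\<close>, then \<open>r * m\<close> is below that bound too, since
      \<open>c\<close> contributes nonnegatively.\<close>
    define R where "R = (d \<bullet> x + 1) / m"
    \<comment> \<open>Inserting 0 covers the case of empty \<open>A\<close>, whose conical hull is
      the origin alone.\<close>
    define B where "B = insert 0 ((\<lambda>(r, a). r *\<^sub>R a) ` ({0..R} \<times> H))"
    have "compact ((\<lambda>(r, a). r *\<^sub>R a) ` ({0..R} \<times> H))"
      using H by (intro compact_continuous_image compact_Times)
        (auto intro!: continuous_intros simp: case_prod_unfold)
    then have "compact B" unfolding B_def by (rule compact_insert)
    then have T: "closed (\<Union>b\<in>B. \<Union>c\<in>C. {b + c})"
      using C by (rule compact_closed_sums)
    have B_sub: "B \<subseteq> convex_cone hull A"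
      using convex_hull_subset_convex_cone_hull[of A]
      by (auto simp: B_def H_def convex_cone_hull_contains_0 intro!: convex_cone_hull_mul)
    let ?U = "{y. d \<bullet> y < d \<bullet> x + 1}"
    have "?U \<inter> ?S \<subseteq> (\<Union>b\<in>B. \<Union>c\<in>C. {b + c})"
    proof
      fix y assume y: "y \<in> ?U \<inter> ?S"
      then obtain z c where zc: "y = z + c" "z \<in> convex_cone hull A" "c \<in> C" by blast
      have "z \<in> B"
      proof (cases "z = 0")
        case False
        then obtain r a where ra: "r \<ge> 0" "a \<in> H" "z = r *\<^sub>R a"
          using convex_cone_hull_decompose[OF zc(2)] unfolding H_def by blast
        have "r * m \<le> r * (d \<bullet> a)" using ra m by (intro mult_left_mono) auto
        also have "\<dots> = d \<bullet> z" using ra by simp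
        also have "\<dots> \<le> d \<bullet> x + 1" using y zc dC[of c] by (simp add: inner_simps)
        finally have "r \<le> R" using m(1) by (simp add: R_def pos_le_divide_eq)
        then show ?thesis using ra by (auto simp: B_def)
      qed (simp add: B_def)
      then show "y \<in> (\<Union>b\<in>B. \<Union>c\<in>C. {b + c})" using zc by blast
    qed
    then have "closure (?U \<inter> ?S) \<subseteq> (\<Union>b\<in>B. \<Union>c\<in>C. {b + c})"
      using T by (rule closure_minimal)
    \<comment> \<open>Being a limit point is local: \<open>?U\<close> is an open neighbourhood of
      \<open>x\<close>.\<close>
    moreover have "x \<in> closure (?U \<inter> ?S)"
      using x open_Int_closure_subset[OF open_halfspace_lt[of d "d \<bullet> x + 1"], of ?S] by auto
    ultimately show ?thesis using B_sub by blast
  qed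
  then show ?thesis by (metis (no_types, lifting) closure_subset closure_eq subsetI subset_antisym)
qed

section \<open>Caratheodory's theorem and the dimension of the symmetric matrices\<close>

text \<open>The hyperplane misses the origin, so the affine dimension of \<open>S\<close> is one
  less than its linear dimension. This saves the extra point in Caratheodory's theorem:
  \<open>N\<close> points suffice instead of \<open>N + 1\<close>.\<close>

lemma caratheodory_hyperplane_slice:
  fixes S V :: "'a::euclidean_space set"
  assumes V: "S \<subseteq> V" "dim V \<le> N" and e: "\<And>x. x \<in> S \<Longrightarrow> e \<bullet> x = 1"
    and x: "x \<in> convex hull S"
  shows "\<exists>(\<alpha> :: nat \<Rightarrow> real) v. (\<forall>i\<in>{1..N}. \<alpha> i \<ge> 0 \<and> v i \<in> S) \<and> x = (\<Sum>i=1..N. \<alpha> i *\<^sub>R v i)"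
proof -
  have "affine hull S \<subseteq> {x. e \<bullet> x = 1}"
    using e by (intro hull_minimal affine_hyperplane) auto
  then have "0 \<notin> affine hull S" by auto
  then have "aff_dim S + 1 = aff_dim (insert 0 S)" by (simp add: aff_dim_insert)
  also have "\<dots> = int (dim (insert 0 S))" by (intro aff_dim_zero hull_inc) simp
  also have "\<dots> \<le> N" using dim_subset[OF V(1)] V(2) by (simp add: dim_insert span_0)
  finally have N: "aff_dim S + 1 \<le> N" .
  obtain F where F: "finite F" "F \<subseteq> S" "int (card F) \<le> aff_dim S + 1" "x \<in> convex hull F"
    using x unfolding caratheodory_aff_dim[of S] by blast
  have FN: "card F \<le> N" using F(3) N by linarith
  obtain u where u: "\<And>y. y \<in> F \<Longrightarrow> u y \<ge> 0" "(\<Sum>y\<in>F. u y *\<^sub>R y) = x"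
    using F(4) unfolding convex_hull_finite[OF F(1)] by blast
  obtain h where h: "bij_betw h {1..card F} F"
    using ex_bij_betw_nat_finite_1[OF F(1)] by blast
  obtain s where s: "s \<in> S" using x by fastforce
  define \<alpha> where "\<alpha> i = (if i \<in> {1..card F} then u (h i) else 0)" for i
  define v where "v i = (if i \<in> {1..card F} then h i else s)" for i
  have hF: "h i \<in> F" if "i \<in> {1..card F}" for i using h that by (rule bij_betwE[rule_format])
  have "x = (\<Sum>i=1..card F. u (h i) *\<^sub>R h i)"
    using sum.reindex_bij_betw[OF h, of "\<lambda>y. u y *\<^sub>R y"] u(2) by simp
  also have "\<dots> = (\<Sum>i=1..card F. \<alpha> i *\<^sub>R v i)"
    by (intro sum.cong) (auto simp: \<alpha>_def v_def)
  also have "\<dots> = (\<Sum>i=1..N. \<alpha> i *\<^sub>R v i)"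
    using FN by (intro sum.mono_neutral_left) (auto simp: \<alpha>_def)
  finally have "x = (\<Sum>i=1..N. \<alpha> i *\<^sub>R v i)" .
  moreover have "\<forall>i\<in>{1..N}. \<alpha> i \<ge> 0 \<and> v i \<in> S"
    using hF u(1) F(2) s by (auto simp: \<alpha>_def v_def)
  ultimately show ?thesis by blast
qed

text \<open>The symmetric matrices are spanned by the matrices \<open>E X\<close> supported on the positions \<open>(i, j)\<close>
  with \<open>{i, j} = X\<close>, where \<open>X\<close> has one or two elements.\<close>

lemma dim_sym_matrices:
  "dim (sym_matrices :: (real^'n^'n) set) \<le> CARD('n) * (CARD('n) + 1) div 2"
proof -
  define E :: "'n set \<Rightarrow> real^'n^'n" where "E X = (\<chi> i j. if {i, j} = X then 1 else 0)" for X
  define P where "P = {X::'n set. card X = 1} \<union> {X. card X = 2}"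
  have inP: "{i, j} \<in> P" for i j :: 'n by (cases "i = j") (auto simp: P_def)
  have "A \<in> span (E ` P)" if A: "A \<in> sym_matrices" for A
  proof -
    have Asym: "A $ i $ j = A $ j $ i" for i j
      using A unfolding sym_matrices_def transpose_def vec_eq_iff mem_Collect_eq by simp
    \<comment> \<open>The choice is unambiguous because symmetry makes the entry depend only on the
      unordered pair.\<close>
    define c where "c X = (SOME r. \<exists>i j. X = {i, j} \<and> r = A $ i $ j)" for X
    have c: "c {i, j} = A $ i $ j" for i j
      unfolding c_def by (rule some_equality) (auto simp: doubleton_eq_iff Asym)
    have "A = (\<Sum>X\<in>P. c X *\<^sub>R E X)"
    proof -
      have "(\<Sum>X\<in>P. c X *\<^sub>R E X) $ i $ j = A $ i $ j" for i j
      proof -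
        have "(\<Sum>X\<in>P. c X *\<^sub>R E X) $ i $ j = (\<Sum>X\<in>P. if {i, j} = X then c X else 0)"
          by (simp add: E_def if_distrib cong: if_cong)
        also have "\<dots> = A $ i $ j" using inP[of i j] by (simp add: c)
        finally show ?thesis .
      qed
      then show ?thesis by (simp add: vec_eq_iff)
    qed
    moreover have "\<dots> \<in> span (E ` P)"
      by (intro span_sum span_scale span_base imageI)
    ultimately show ?thesis by simp
  qed
  then have "dim (sym_matrices :: (real^'n^'n) set) \<le> card (E ` P)"
    by (intro dim_le_card) auto
  also have "\<dots> \<le> card P" by (intro card_image_le) simp
  also have "\<dots> \<le> card {X::'n set. card X = 1} + card {X::'n set. card X = 2}"
    unfolding P_def by (rule card_Un_le)
  also have "\<dots> = CARD('n) + (CARD('n) choose 2)"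
    using n_subsets[of "UNIV :: 'n set" 1] n_subsets[of "UNIV :: 'n set" 2] by simp
  also have "\<dots> = CARD('n) * (CARD('n) + 1) div 2"
  proof -
    \<comment> \<open>Evenness makes the truncating division exact.\<close>
    have "even (CARD('n) * (CARD('n) - 1))" by auto
    moreover have "CARD('n) * (CARD('n) + 1) = 2 * CARD('n) + CARD('n) * (CARD('n) - 1)"
      by (cases "CARD('n)") auto
    ultimately show ?thesis by (simp add: choose_two)
  qed
  finally show ?thesis .
qed

section \<open>The polyhedral cone of the vertex terms\<close>

text \<open>The generator built from \<open>axis k 1\<close> and \<open>\<tau>\<close> carries the \<open>k\<close>-th component of \<open>\<lambda>\<close> at \<open>\<tau>\<close>;
  for \<open>k \<in> M \<tau>\<close>, where this component is free, both signs are generators.\<close>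

definition edge_generators :: "(real^'n) set \<Rightarrow> (real^'n \<Rightarrow> 'n set) \<Rightarrow> (real^'n^'n) set" where
  "edge_generators Z M =
     {outer (r *\<^sub>R axis k 1) \<tau> + outer \<tau> (r *\<^sub>R axis k 1) | r k \<tau>.
        \<tau> \<in> Z \<and> (r = 1 \<or> r = -1 \<and> k \<in> M \<tau>)}"

lemma finite_edge_generators:
  assumes "finite Z"
  shows "finite (edge_generators Z M)"
proof (rule finite_subset)
  show "edge_generators Z M \<subseteq> (\<lambda>(r, k, \<tau>). outer (r *\<^sub>R axis k 1) \<tau> + outer \<tau> (r *\<^sub>R axis k 1)) `
      ({1, -1} \<times> UNIV \<times> Z)"
  proof
    fix x assume "x \<in> edge_generators Z M"
    then obtain r k \<tau> where "x = outer (r *\<^sub>R axis k 1) \<tau> + outer \<tau> (r *\<^sub>R axis k 1)"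
      "(r, k, \<tau>) \<in> {1, -1} \<times> UNIV \<times> Z"
      unfolding edge_generators_def by auto
    then show "x \<in> (\<lambda>(r, k, \<tau>). outer (r *\<^sub>R axis k 1) \<tau> + outer \<tau> (r *\<^sub>R axis k 1)) `
        ({1, -1} \<times> UNIV \<times> Z)"
      by (intro image_eqI[of _ _ "(r, k, \<tau>)"]) auto
  qed
qed (use assms in simp)

lemma edge_cone_representation:
  fixes Z :: "(real^'n) set"
  assumes Z: "finite Z" and C: "C \<in> convex_cone hull edge_generators Z M"
  shows "\<exists>lam. C = (\<Sum>\<tau>\<in>Z. outer (lam \<tau>) \<tau> + outer \<tau> (lam \<tau>)) \<and>
    (\<forall>\<tau>\<in>Z. \<forall>k\<in>UNIV - M \<tau>. lam \<tau> $ k \<ge> 0)"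
proof -
  define f :: "(real^'n \<Rightarrow> real^'n) \<Rightarrow> real^'n^'n"
    where "f lam = (\<Sum>\<tau>\<in>Z. outer (lam \<tau>) \<tau> + outer \<tau> (lam \<tau>))" for lam
  define \<Lambda> where "\<Lambda> = {lam. \<forall>\<tau>\<in>Z. \<forall>k\<in>UNIV - M \<tau>. lam \<tau> $ k \<ge> (0::real)}"
  have f0: "f (\<lambda>_. 0) = 0" by (simp add: f_def outer_zero)
  have fadd: "f a + f b = f (\<lambda>\<tau>. a \<tau> + b \<tau>)" for a b
    by (simp add: f_def outer_add_left outer_add_right algebra_simps flip: sum.distrib)
  have fscale: "c *\<^sub>R f a = f (\<lambda>\<tau>. c *\<^sub>R a \<tau>)" for c a
    by (simp add: f_def outer_scaleR_left outer_scaleR_right scaleR_sum_right scaleR_right_distrib)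
  have "convex_cone (f ` \<Lambda>)"
    unfolding convex_cone_iff
  proof (intro conjI ballI allI impI)
    show "0 \<in> f ` \<Lambda>" using f0 by (intro image_eqI[of _ _ "\<lambda>_. 0"]) (auto simp: \<Lambda>_def)
  next
    fix x y assume "x \<in> f ` \<Lambda>" "y \<in> f ` \<Lambda>"
    then obtain a b where "a \<in> \<Lambda>" "b \<in> \<Lambda>" "x = f a" "y = f b" by blast
    then show "x + y \<in> f ` \<Lambda>" by (auto simp: fadd \<Lambda>_def)
  next
    fix x and c :: real assume "x \<in> f ` \<Lambda>" "0 \<le> c"
    then obtain a where "a \<in> \<Lambda>" "x = f a" by blast
    then show "c *\<^sub>R x \<in> f ` \<Lambda>" using \<open>0 \<le> c\<close> by (auto simp: fscale \<Lambda>_def)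
  qed
  moreover have "edge_generators Z M \<subseteq> f ` \<Lambda>"
  proof
    fix x assume "x \<in> edge_generators Z M"
    then obtain r k \<tau> where x: "x = outer (r *\<^sub>R axis k 1) \<tau> + outer \<tau> (r *\<^sub>R axis k 1)"
      and \<tau>: "\<tau> \<in> Z" "r = 1 \<or> r = -1 \<and> k \<in> M \<tau>"
      unfolding edge_generators_def by blast
    define lam where "lam \<rho> = (if \<rho> = \<tau> then r *\<^sub>R axis k 1 else (0::real^'n))" for \<rho>
    have "f lam = (\<Sum>\<rho>\<in>Z. if \<rho> = \<tau> then x else 0)"
      unfolding f_def by (intro sum.cong) (auto simp: lam_def x outer_zero)
    also have "\<dots> = x" using Z \<tau> by simp
    finally have "x = f lam" by simp
    moreover have "lam \<in> \<Lambda>" using \<tau> by (auto simp: \<Lambda>_def lam_def axis_def)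
    ultimately show "x \<in> f ` \<Lambda>" by blast
  qed
  ultimately have "convex_cone hull edge_generators Z M \<subseteq> f ` \<Lambda>" by (intro hull_minimal)
  then show ?thesis using C by (auto simp: f_def \<Lambda>_def)
qed

section \<open>The two inclusions and the theorem\<close>

lemma inner_symmetric_outer:
  assumes "D \<in> sym_matrices"
  shows "D \<bullet> (outer x y + outer y x) = 2 * (x \<bullet> (D *v y))"
  using sym_bilinear_commute[OF assms, of x y] by (simp add: inner_add_right inner_outer)

lemma copositive_zeros_grad_nonneg:
  assumes "K \<subseteq> copositive" "D \<in> K" "\<tau> \<in> zeros K"
  shows "(D *v \<tau>) $ k \<ge> 0"
  using assms by (intro copositive_zero_gradient_nonneg) (auto simp: zeros_def simplexT_def)

text \<open>Each summand pairs nonnegatively with each \<open>D\<close> in \<open>K\<close>: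
  coordinates of \<open>lam \<tau>\<close> with free sign meet zero coordinates of
  \<open>D *v \<tau>\<close>, and all others are products of nonnegative numbers.\<close>

lemma G_bar_subset_dual_cone:
  fixes K :: "(real^'n^'n) set"
  assumes K: "K \<subseteq> copositive"
  shows "G_bar K \<subseteq> dual_cone K"
proof
  fix B assume "B \<in> G_bar K"
  then obtain \<alpha> :: "nat \<Rightarrow> real" and \<mu> lam where B: "B \<in> sym_matrices"
    "B = (\<Sum>i = 1..CARD('n) * (CARD('n) + 1) div 2. \<alpha> i *\<^sub>R outer (\<mu> i) (\<mu> i))
       + (\<Sum>\<tau>\<in>zero_vertices K. outer (lam \<tau>) \<tau> + outer \<tau> (lam \<tau>))"
    and \<alpha>: "\<And>i. i \<in> {1..CARD('n) * (CARD('n) + 1) div 2} \<Longrightarrow> \<alpha> i \<ge> 0 \<and>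
        (if Omega (zero_vertices K) = {} then \<alpha> i = 0 else \<mu> i \<in> Omega (zero_vertices K))"
    and lam: "\<And>\<tau> k. \<tau> \<in> zero_vertices K \<Longrightarrow> k \<notin> M_set K \<tau> \<Longrightarrow> lam \<tau> $ k \<ge> 0"
    unfolding G_bar_def by blast
  have "D \<bullet> B \<ge> 0" if D: "D \<in> K" for D
  proof -
    have D': "D \<in> copositive" "D \<in> sym_matrices" using D K by (auto simp: copositive_def)
    have "D \<bullet> (\<alpha> i *\<^sub>R outer (\<mu> i) (\<mu> i)) \<ge> 0"
      if "i \<in> {1..CARD('n) * (CARD('n) + 1) div 2}" for i
      using \<alpha>[OF that] D'(1)
      by (auto simp: inner_outer copositive_def Omega_def simplexT_def split: if_splits)
    moreover have "D \<bullet> (outer (lam \<tau>) \<tau> + outer \<tau> (lam \<tau>)) \<ge> 0" if \<tau>: "\<tau> \<in> zero_vertices K" for \<tau>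
    proof -
      have "lam \<tau> $ k * (D *v \<tau>) $ k \<ge> 0" for k
      proof (cases "k \<in> M_set K \<tau>")
        case True
        then show ?thesis using D by (simp add: M_set_def)
      next
        case False
        have "\<tau> \<in> zeros K" using \<tau> zero_vertices_subset by blast
        then show ?thesis
          using lam[OF \<tau> False] copositive_zeros_grad_nonneg[OF K D] by (intro mult_nonneg_nonneg)
      qed
      then show ?thesis
        unfolding inner_symmetric_outer[OF D'(2)] by (simp add: inner_vec_def sum_nonneg)
    qed
    ultimately show ?thesis
      unfolding B(2) inner_add_right[of D "sum f A" "sum g C" for f A g C] inner_sum_right
      by (intro add_nonneg_nonneg sum_nonneg) auto
  qed
  then show "B \<in> dual_cone K"
    using B(1) by (simp add: dual_cone_def trace_mult_symmetric)
qed

text \<open>\<open>complete\<close> says that \<open>K\<close> is cut out by the inequalities dual to the generators of \<open>G_bar K\<close>.\<close>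

lemma dual_cone_subset_G_bar:
  fixes K :: "(real^'n^'n) set"
  assumes K: "K \<subseteq> copositive" "convex_cone K" and ne: "zeros K \<noteq> {}"
    and complete: "\<And>D. D \<in> sym_matrices \<Longrightarrow>
      (\<And>\<tau> k. \<tau> \<in> zero_vertices K \<Longrightarrow> (D *v \<tau>) $ k \<ge> 0) \<Longrightarrow>
      (\<And>\<tau> k. \<tau> \<in> zero_vertices K \<Longrightarrow> k \<in> M_set K \<tau> \<Longrightarrow> (D *v \<tau>) $ k = 0) \<Longrightarrow>
      (\<And>\<mu>. \<mu> \<in> Omega (zero_vertices K) \<Longrightarrow> \<mu> \<bullet> (D *v \<mu>) \<ge> 0) \<Longrightarrow> D \<in> K"
  shows "dual_cone K \<subseteq> G_bar K"
proof
  fix B assume B: "B \<in> dual_cone K"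
  define Z where "Z = zero_vertices K"
  define A where "A = (\<lambda>\<mu>. outer \<mu> \<mu>) ` Omega Z"
  define F where "F = edge_generators Z (M_set K)"
  let ?S = "{x + c | x c. x \<in> convex_cone hull A \<and> c \<in> convex_cone hull F}"
  have Bsym: "B \<in> sym_matrices" using B by (simp add: dual_cone_def)
  have ZK: "Z \<subseteq> zeros K" unfolding Z_def by (rule zero_vertices_subset)
  have hull: "convex hull Z = convex hull zeros K"
    unfolding Z_def by (rule convex_hull_zero_vertices)
  have Z: "finite Z" "Z \<noteq> {}" "Z \<subseteq> simplexT"
  proof -
    show "finite Z" unfolding Z_def using K(1) by (rule finite_zero_vertices)
    show "Z \<noteq> {}" using hull ne by (metis convex_hull_eq_empty)
    show "Z \<subseteq> simplexT" using ZK by (auto simp: zeros_def)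
  qed
  \<comment> \<open>This disjointness supplies the matrix \<open>D0\<close>, strictly positive on
    \<open>A\<close>, which the closedness lemma requires.\<close>
  have "Omega Z \<inter> zeros K = {}"
    using Omega_disjoint_hull[OF Z] hull hull_subset[of "zeros K" convex] by blast
  then have "Omega Z \<subseteq> simplexT - zeros K" by (auto simp: Omega_def)
  then obtain D0 where D0: "D0 \<in> K" "\<And>\<mu>. \<mu> \<in> Omega Z \<Longrightarrow> \<mu> \<bullet> (D0 *v \<mu>) > 0"
    using ex_positive_off_zeros[OF K] by blast
  have D0sym: "D0 \<in> sym_matrices" using D0(1) K(1) by (auto simp: copositive_def)
  have "continuous_on (Omega Z) (\<lambda>\<mu>. outer \<mu> \<mu>)"
    unfolding outer_def by (intro continuous_intros)
  then have "compact A"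
    unfolding A_def using compact_Omega[OF Z(2)] by (intro compact_continuous_image)
  moreover have "closed (convex_cone hull F)"
    unfolding F_def using finite_edge_generators[OF Z(1)] by (rule closed_convex_cone_hull)
  moreover have "D0 \<bullet> a > 0" if "a \<in> A" for a
    using that D0(2) by (auto simp: A_def inner_outer)
  moreover have "D0 \<bullet> c \<ge> 0" if c: "c \<in> convex_cone hull F" for c
  proof -
    have "D0 \<bullet> g \<ge> 0" if gF: "g \<in> F" for g
    proof -
      obtain r k \<tau> where g: "g = outer (r *\<^sub>R axis k 1) \<tau> + outer \<tau> (r *\<^sub>R axis k 1)"
        and \<tau>: "\<tau> \<in> Z" "r = 1 \<or> r = -1 \<and> k \<in> M_set K \<tau>"
        using gF unfolding F_def edge_generators_def by blast
      have "(D0 *v \<tau>) $ k \<ge> 0" using copositive_zeros_grad_nonneg K(1) D0(1) \<tau>(1) ZK by blast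
      moreover have "(D0 *v \<tau>) $ k = 0" if "k \<in> M_set K \<tau>" using that D0(1) by (simp add: M_set_def)
      ultimately show ?thesis
        unfolding g inner_symmetric_outer[OF D0sym] using \<tau>(2) by auto
    qed
    then have "convex_cone hull F \<subseteq> {x. D0 \<bullet> x \<ge> 0}"
      by (intro hull_minimal convex_cone_halfspace_ge) auto
    then show ?thesis using c by blast
  qed
  ultimately have closed: "closed ?S" by (rule closed_compactly_generated_plus_closed_cone)
  have cone: "convex_cone ?S"
  proof -
    have "?S = (\<Union>x\<in>convex_cone hull A. \<Union>c\<in>convex_cone hull F. {x + c})" by blast
    then show ?thesis by (simp add: convex_cone_sums convex_cone_convex_cone_hull)
  qed
  have A_sub: "a \<in> ?S" if "a \<in> A" for a
    using hull_inc[OF that, of convex_cone] convex_cone_hull_contains_0[of F]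
    by (intro CollectI exI[of _ a] exI[of _ 0]) simp
  have F_sub: "g \<in> ?S" if "g \<in> F" for g
    using hull_inc[OF that, of convex_cone] convex_cone_hull_contains_0[of A]
    by (intro CollectI exI[of _ 0] exI[of _ g]) simp
  have "B \<in> ?S"
  proof (rule ccontr)
    assume "B \<notin> ?S"
    then obtain a where a: "a \<bullet> B < 0" "\<And>y. y \<in> ?S \<Longrightarrow> a \<bullet> y \<ge> 0"
      by (rule convex_cone_separation[OF closed cone]) (rule that)
    \<comment> \<open>The separating matrix \<open>a\<close> need not be symmetric. Symmetrising it
      merely doubles its pairing with symmetric matrices, including \<open>B\<close> and all
      generators.\<close>
    define D where "D = a + transpose a"
    have Dsym: "D \<in> sym_matrices"
      by (simp add: D_def sym_matrices_def transpose_def vec_eq_iff)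
    have D_inner: "D \<bullet> X = 2 * (a \<bullet> X)" if "X \<in> sym_matrices" for X
      using that by (simp add: D_def inner_add_left transpose_inner sym_matrices_def)
    have edge: "r * (D *v \<tau>) $ k \<ge> 0" if "\<tau> \<in> Z" "r = 1 \<or> r = -1 \<and> k \<in> M_set K \<tau>" for r k \<tau>
    proof -
      let ?g = "outer (r *\<^sub>R axis k 1) \<tau> + outer \<tau> (r *\<^sub>R axis k 1)"
      have "?g \<in> F" unfolding F_def edge_generators_def using that by blast
      then have "D \<bullet> ?g \<ge> 0" using D_inner[OF outer_sym(2)] a(2) F_sub by simp
      then show ?thesis unfolding inner_symmetric_outer[OF Dsym] by simp
    qed
    have "D \<in> K"
    proof (rule complete[folded Z_def])
      fix \<mu> assume "\<mu> \<in> Omega Z"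
      then have "a \<bullet> outer \<mu> \<mu> \<ge> 0" using a(2) A_sub by (simp add: A_def)
      then show "\<mu> \<bullet> (D *v \<mu>) \<ge> 0" using D_inner[OF outer_sym(1), of \<mu>] by (simp add: inner_outer)
    next
      fix \<tau> k assume "\<tau> \<in> Z" "k \<in> M_set K \<tau>"
      then show "(D *v \<tau>) $ k = 0" using edge[of \<tau> 1 k] edge[of \<tau> "-1" k] by simp
    qed (use Dsym edge[of _ 1] in auto)
    then have "trace (D ** B) \<ge> 0" using B by (simp add: dual_cone_def)
    then show False using a(1) D_inner[OF Bsym] Bsym by (simp add: trace_mult_symmetric)
  qed
  then obtain x c where xc: "B = x + c" "x \<in> convex_cone hull A" "c \<in> convex_cone hull F"
    by blast
  obtain lam where lam: "c = (\<Sum>\<tau>\<in>Z. outer (lam \<tau>) \<tau> + outer \<tau> (lam \<tau>))"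
    "\<forall>\<tau>\<in>Z. \<forall>k\<in>UNIV - M_set K \<tau>. lam \<tau> $ k \<ge> 0"
    using edge_cone_representation[OF Z(1) xc(3)[unfolded F_def]] by blast
  let ?N = "CARD('n) * (CARD('n) + 1) div 2"
  have "\<exists>(\<alpha> :: nat \<Rightarrow> real) \<mu>. x = (\<Sum>i = 1..?N. \<alpha> i *\<^sub>R outer (\<mu> i) (\<mu> i)) \<and>
      (\<forall>i\<in>{1..?N}. \<alpha> i \<ge> 0 \<and> (if Omega Z = {} then \<alpha> i = 0 else \<mu> i \<in> Omega Z))"
  proof (cases "x = 0")
    case True
    \<comment> \<open>All coefficients are zero, but the vectors must still come from
      \<open>Omega Z\<close> whenever it is nonempty.\<close>
    show ?thesis
      by (rule exI[of _ "\<lambda>_. 0"], rule exI[of _ "\<lambda>_. SOME \<mu>. \<mu> \<in> Omega Z"])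
        (auto simp: True some_in_eq)
  next
    case False
    then obtain r y where ry: "r \<ge> 0" "y \<in> convex hull A" "x = r *\<^sub>R y"
      using convex_cone_hull_decompose[OF xc(2)] by blast
    \<comment> \<open>Pairing with the all-ones matrix gives the squared coordinate sum, so
      \<open>A\<close> lies in a hyperplane missing the origin.\<close>
    define e :: "real^'n^'n" where "e = (\<chi> i j. 1)"
    have "e \<bullet> outer \<mu> \<mu> = 1" if "\<mu> \<in> simplexT" for \<mu>
    proof -
      have "e \<bullet> outer \<mu> \<mu> = (\<Sum>i\<in>UNIV. \<mu> $ i) * (\<Sum>j\<in>UNIV. \<mu> $ j)"
        by (simp add: e_def inner_vec_def outer_def sum_product)
      then show ?thesis using that by (simp add: simplexT_def)
    qed
    then have e: "e \<bullet> v = 1" if "v \<in> A" for v using that by (auto simp: A_def Omega_def)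
    have "A \<subseteq> sym_matrices" by (auto simp: A_def outer_sym)
    then obtain \<alpha> :: "nat \<Rightarrow> real" and v
      where v: "\<forall>i\<in>{1..?N}. \<alpha> i \<ge> 0 \<and> v i \<in> A" "y = (\<Sum>i=1..?N. \<alpha> i *\<^sub>R v i)"
      using caratheodory_hyperplane_slice[OF _ dim_sym_matrices e ry(2)] by blast
    have "\<forall>i\<in>{1..?N}. \<exists>\<mu>\<in>Omega Z. v i = outer \<mu> \<mu>" using v(1) by (auto simp: A_def)
    then obtain \<mu> where \<mu>: "\<And>i. i \<in> {1..?N} \<Longrightarrow> \<mu> i \<in> Omega Z \<and> v i = outer (\<mu> i) (\<mu> i)"
      by metis
    have "x = (\<Sum>i=1..?N. (r * \<alpha> i) *\<^sub>R outer (\<mu> i) (\<mu> i))"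
      using \<mu> unfolding ry(3) v(2) scaleR_sum_right by (intro sum.cong) auto
    moreover have "\<forall>i\<in>{1..?N}. r * \<alpha> i \<ge> 0 \<and>
        (if Omega Z = {} then r * \<alpha> i = 0 else \<mu> i \<in> Omega Z)"
    proof
      fix i assume i: "i \<in> {1..?N}"
      have "\<mu> i \<in> Omega Z" "r * \<alpha> i \<ge> 0" using \<mu>[OF i] v(1) i ry(1) by auto
      then show "r * \<alpha> i \<ge> 0 \<and> (if Omega Z = {} then r * \<alpha> i = 0 else \<mu> i \<in> Omega Z)"
        by auto
    qed
    ultimately show ?thesis by (intro exI[of _ "\<lambda>i. r * \<alpha> i"] exI[of _ \<mu>] conjI)
  qed
  then obtain \<alpha> :: "nat \<Rightarrow> real" and \<mu> where
    \<alpha>: "x = (\<Sum>i = 1..?N. \<alpha> i *\<^sub>R outer (\<mu> i) (\<mu> i))"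
      "\<forall>i\<in>{1..?N}. \<alpha> i \<ge> 0 \<and> (if Omega Z = {} then \<alpha> i = 0 else \<mu> i \<in> Omega Z)"
    by blast
  show "B \<in> G_bar K"
    unfolding G_bar_def mem_Collect_eq Z_def[symmetric]
    using Bsym xc(1) \<alpha> lam by (intro conjI exI[of _ \<alpha>] exI[of _ \<mu>] exI[of _ lam]) auto
qed

theorem theorem3:
  fixes t :: "'i \<Rightarrow> real^'n" and I :: "'i set" and L :: "'i \<Rightarrow> 'n set"
    and K :: "(real^'n^'n) set"
  assumes "CARD('n) > 1"
    and "finite I" and "I \<noteq> {}"
    and "\<And>i. i \<in> I \<Longrightarrow> t i \<in> simplexT"
    and "\<And>i. i \<in> I \<Longrightarrow> pos_support (t i) \<subseteq> L i"
    and "K = {D \<in> copositive. \<forall>i\<in>I. \<forall>k\<in>L i. axis k 1 \<bullet> (D *v t i) = 0}"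
  shows "dual_cone K = G_bar K"
proof (rule antisym)
  note K_def = assms(6)
  have K: "K \<subseteq> copositive" by (auto simp: K_def)
  have cone: "convex_cone K"
    unfolding convex_cone_iff K_def
    by (auto simp: copositive_def sym_matrices_def transpose_def vec_eq_iff
        matrix_vector_mult_add_rdistrib inner_add_right simp flip: scaleR_matrix_vector_assoc)
  \<comment> \<open>Each product of a coordinate of \<open>t i\<close> and one of
    \<open>D *v t i\<close> vanishes: the second factor is zero on \<open>L i\<close>, the first is
    zero off \<open>L i\<close>.\<close>
  have tz: "t i \<in> zeros K" if i: "i \<in> I" for i
  proof -
    have "t i \<bullet> (D *v t i) = 0" if D: "D \<in> K" for D
    proof -
      have "t i $ k * (D *v t i) $ k = 0" for k
      proof (cases "k \<in> L i")
        case True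
        then show ?thesis using D i by (simp add: K_def)
      next
        case False
        then have "\<not> t i $ k > 0" using assms(5)[OF i] by (auto simp: pos_support_def)
        then show ?thesis using simplexT_nonneg[OF assms(4)[OF i], of k] by simp
      qed
      then show ?thesis by (auto simp: inner_vec_def intro!: sum.neutral)
    qed
    then show ?thesis using assms(4)[OF i] by (simp add: zeros_def)
  qed
  then have ne: "zeros K \<noteq> {}" using assms(3) by blast
  let ?Z = "zero_vertices K"
  have Z: "finite ?Z" "?Z \<noteq> {}" "?Z \<subseteq> simplexT"
  proof -
    show "finite ?Z" using K by (rule finite_zero_vertices)
    show "?Z \<noteq> {}"
      using convex_hull_zero_vertices[of K] ne by (metis convex_hull_eq_empty)
    show "?Z \<subseteq> simplexT" using zero_vertices_subset[of K] by (auto simp: zeros_def)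
  qed
  show "G_bar K \<subseteq> dual_cone K" using K by (rule G_bar_subset_dual_cone)
  show "dual_cone K \<subseteq> G_bar K"
  proof (rule dual_cone_subset_G_bar[OF K cone ne])
    fix D :: "real^'n^'n"
    assume D: "D \<in> sym_matrices" "\<And>\<tau> k. \<tau> \<in> ?Z \<Longrightarrow> (D *v \<tau>) $ k \<ge> 0"
      "\<And>\<tau> k. \<tau> \<in> ?Z \<Longrightarrow> k \<in> M_set K \<tau> \<Longrightarrow> (D *v \<tau>) $ k = 0"
      "\<And>\<mu>. \<mu> \<in> Omega ?Z \<Longrightarrow> \<mu> \<bullet> (D *v \<mu>) \<ge> 0"
    have "D \<in> copositive" using D(1) Z D(2,4) by (rule copositiveI_Omega)
    moreover have "(D *v t i) $ k = 0" if ik: "i \<in> I" "k \<in> L i" for i k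
    proof -
      have "t i \<in> convex hull ?Z"
        using tz[OF ik(1)] hull_inc[of "t i" "zeros K" convex] by (simp add: convex_hull_zero_vertices)
      then obtain u where u: "\<forall>\<tau>\<in>?Z. u \<tau> \<ge> 0" "(\<Sum>\<tau>\<in>?Z. u \<tau> *\<^sub>R \<tau>) = t i"
        unfolding convex_hull_finite[OF Z(1)] by blast
      have expand: "(E *v t i) $ k = (\<Sum>\<tau>\<in>?Z. u \<tau> * (E *v \<tau>) $ k)" for E :: "real^'n^'n"
        by (simp add: matrix_vector_mul_component inner_sum_right flip: u(2))
      have "u \<tau> * (D *v \<tau>) $ k = 0" if \<tau>: "\<tau> \<in> ?Z" for \<tau>
      proof (cases "u \<tau> = 0")
        case False
        \<comment> \<open>For \<open>E\<close> in \<open>K\<close> the expansion sums to zero with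
          nonnegative terms, so a positive weight forces this coordinate to vanish. Hence
          \<open>k\<close> lies in \<open>M_set K \<tau>\<close>, where \<open>D\<close> is assumed
          to vanish as well.\<close>
        have "(E *v \<tau>) $ k = 0" if E: "E \<in> K" for E
        proof -
          have "(\<Sum>\<tau>\<in>?Z. u \<tau> * (E *v \<tau>) $ k) = 0"
            using E ik expand[of E] by (simp add: K_def)
          moreover have "u \<rho> * (E *v \<rho>) $ k \<ge> 0" if \<rho>: "\<rho> \<in> ?Z" for \<rho>
          proof -
            have "\<rho> \<in> zeros K" using \<rho> zero_vertices_subset by blast
            then show ?thesis
              using u(1) \<rho> copositive_zeros_grad_nonneg[OF K E] by (intro mult_nonneg_nonneg) auto
          qed
          ultimately show ?thesis
            using Z(1) \<tau> False by (auto simp: sum_nonneg_eq_0_iff)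
        qed
        then show ?thesis using D(3)[OF \<tau>] by (simp add: M_set_def)
      qed simp
      then show ?thesis unfolding expand by (intro sum.neutral) blast
    qed
    ultimately show "D \<in> K" by (simp add: K_def)
  qed
qed

end
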